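(* Let $d\in\mathbb{N}$, let $0\le k<d$, and let $\mathcal{F}$ be an infinite collection of axis-parallel boxes in $\mathbb{R}^d$. Suppose $\mathcal{F}$ satisfies the $(\aleph_0,2)$-property for axis-parallel $k$-flats, i.e. for every infinite sequence $\{S_n\}_{n\in\mathbb{N}}$ with $S_n\in\mathcal{F}$ for all $n$, there exist indices $i\neq j$ and a single axis-parallel $k$-flat $K$ with $K\cap S_i\neq\emptyset$ and $K\cap S_j\neq\emptyset$. Then $\mathcal{F}$ has an axis-parallel $k$-transversal of finite (constant) size, i.e. there is a finite family $\mathcal{K}$ of axis-parallel $k$-flats such that every box in $\mathcal{F}$ intersects some member of $\mathcal{K}$.
   Context: An axis-parallel box in $\mathbb{R}^d$ is a set $[a_1,b_1]\times\cdots\times[a_d,b_d]$ with $a_i\le b_i$ real for all $i$. An axis-parallel $k$-flat in $\mathbb{R}^d$ is a set of the form $\{x\in\mathbb{R}^d : x_i=c_i \text{ for all } i\in I\}$ where $I\subseteq\{1,\dots,d\}$ has $|I|=d-k$ and $c_i\in\mathbb{R}$ are fixed (so an axis-parallel $0$-flat is a point and an axis-parallel $(d-1)$-flat is an axis-parallel hyperplane). A family $\mathcal{K}$ of sets is a transversal of $\mathcal{F}$ if every member of $\mathcal{F}$ intersects some member of $\mathcal{K}$. *)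

theory Defs
  imports "HOL-Analysis.Analysis"
begin

definition axis_parallel_box :: "(real ^ 'd) set \<Rightarrow> bool" where
  "axis_parallel_box B \<longleftrightarrow> (\<exists>a b. (\<forall>i. a $ i \<le> b $ i) \<and> B = cbox a b)"

text \<open>The condition \<open>card I = d - k\<close> is written additively, so that there is no
  \<open>k\<close>-flat at all when \<open>k\<close> exceeds the dimension.\<close>

definition axis_parallel_flat :: "nat \<Rightarrow> (real ^ 'd) set \<Rightarrow> bool" where
  "axis_parallel_flat k K \<longleftrightarrow>
     (\<exists>(I :: 'd set) (c :: 'd \<Rightarrow> real). card I + k = CARD('d) \<and> K = {x. \<forall>i\<in>I. x $ i = c i})"

definition transversal :: "'a set set \<Rightarrow> 'a set set \<Rightarrow> bool" where
  "transversal \<K> \<F> \<longleftrightarrow> (\<forall>S\<in>\<F>. \<exists>K\<in>\<K>. K \<inter> S \<noteq> {})"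

definition aleph0_2_property :: "nat \<Rightarrow> (real ^ 'd) set set \<Rightarrow> bool" where
  "aleph0_2_property k \<F> \<longleftrightarrow>
     (\<forall>S :: nat \<Rightarrow> (real ^ 'd) set. (\<forall>n. S n \<in> \<F>) \<longrightarrow>
        (\<exists>i j K. i \<noteq> j \<and> axis_parallel_flat k K \<and> K \<inter> S i \<noteq> {} \<and> K \<inter> S j \<noteq> {}))"

end

theory Submission
  imports Defs
begin

text \<open>
  Suppose that no finite family of flats meets all boxes. The sets of boxes missed by single
  flats then generate a proper filter, which we refine to an ultrafilter. Call a coordinate good
  if some real number lies in the projections of almost all boxes. The good coordinates
  cannot carry a \<open>k\<close>-flat, since that flat would meet almost all boxes. In every other
  coordinate the ultrafilter determines a cut towards which the projections of the boxes converge
  without containing it, hence almost every box is disjoint in that coordinate from almost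
  every other one. A sequence chosen one box at a time then violates the hypothesis.
\<close>

text \<open>Zorn's lemma, applied to the proper filters below \<open>L\<close>, gives a minimal one.
  It decides every \<open>P\<close>: adjoining \<open>P\<close> either collapses it, so that
  \<open>P\<close> fails almost everywhere, or by minimality leaves it unchanged, so that
  \<open>P\<close> already holds almost everywhere.\<close>

lemma ultrafilter_le_exists:
  fixes L :: "'a filter"
  assumes "L \<noteq> bot"
  obtains U where "U \<le> L" "U \<noteq> bot" "\<And>P. eventually P U \<or> eventually (\<lambda>x. \<not> P x) U"
proof -
  define A where "A = {U. U \<noteq> bot \<and> U \<le> L}"
  have po: "partial_order_on A (relation_of (\<ge>) A)"
    by (rule partial_order_on_relation_ofI) auto
  have "\<exists>m\<in>A. \<forall>a\<in>A. m \<ge> a \<longrightarrow> a = m"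
  proof (rule predicate_Zorn[OF po])
    fix C assume C: "C \<in> Chains (relation_of (\<ge>) A)"
    have CA: "C \<subseteq> A" and tot: "\<And>x y. x \<in> C \<Longrightarrow> y \<in> C \<Longrightarrow> x \<le> y \<or> y \<le> x"
      using C by (auto simp: Chains_def relation_of_def)
    show "\<exists>u\<in>A. \<forall>a\<in>C. a \<ge> u"
    proof (cases "C = {}")
      case True
      then show ?thesis using assms by (auto simp: A_def)
    next
      case False
      \<comment> \<open>A chain is closed under binary infima, so an event of \<open>Inf C\<close>
        is already an event of a single member; hence \<open>False\<close> is not one.\<close>
      have "eventually P (Inf C) \<longleftrightarrow> (\<exists>F\<in>C. eventually P F)" for P
        by (rule eventually_Inf_base[OF False]) (metis inf.absorb1 inf.absorb2 order_refl tot)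
      then have "Inf C \<noteq> bot"
        using CA by (force simp: A_def trivial_limit_def)
      moreover have "Inf C \<le> L"
        using False CA by (force simp: A_def intro: Inf_lower2)
      ultimately show ?thesis
        by (auto simp: A_def intro: Inf_lower)
    qed
  qed
  then obtain U where U: "U \<noteq> bot" "U \<le> L" and max: "\<And>V. V \<noteq> bot \<Longrightarrow> V \<le> U \<Longrightarrow> V = U"
    by (metis (mono_tags, lifting) A_def mem_Collect_eq order_trans)
  have "eventually P U \<or> eventually (\<lambda>x. \<not> P x) U" for P
  proof (cases "inf U (principal {x. P x}) = bot")
    case True
    then have "eventually (\<lambda>x. False) (inf U (principal {x. P x}))" by simp
    then show ?thesis by (auto simp: eventually_inf_principal)
  next
    case False
    then have "inf U (principal {x. P x}) = U" using max by simp
    then have "U \<le> principal {x. P x}" by (metis inf.cobounded2)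
    then show ?thesis by (simp add: le_principal)
  qed
  with U that show thesis by blast
qed

text \<open>Every real lies strictly to the left (\<open>L\<close>) or strictly to the right
  (\<open>R\<close>) of almost all intervals. If \<open>b x\<close> is in \<open>L\<close> or
  \<open>a x\<close> is in \<open>R\<close>, then almost all intervals lie beyond interval
  \<open>x\<close> on one side. It remains to show that almost every \<open>x\<close> is of this
  kind.\<close>

lemma ultrafilter_intervals_disjoint:
  fixes a b :: "'a \<Rightarrow> real"
  assumes "U \<noteq> bot" and ultra: "\<And>P. eventually P U \<or> eventually (\<lambda>x. \<not> P x) U"
    and le: "eventually (\<lambda>x. a x \<le> b x) U"
    and notin: "\<And>t. \<not> eventually (\<lambda>x. a x \<le> t \<and> t \<le> b x) U"
  shows "eventually (\<lambda>x. eventually (\<lambda>y. b x < a y \<or> b y < a x) U) U"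
proof -
  define L R where "L = {t. eventually (\<lambda>x. t < a x) U}" and "R = {t. eventually (\<lambda>x. b x < t) U}"
  have LR: "t \<in> L \<or> t \<in> R" for t
  proof (rule ccontr)
    assume "\<not> (t \<in> L \<or> t \<in> R)"
    then have "eventually (\<lambda>x. \<not> t < a x) U" "eventually (\<lambda>x. \<not> b x < t) U"
      using ultra by (auto simp: L_def R_def)
    then have "eventually (\<lambda>x. a x \<le> t \<and> t \<le> b x) U"
      by eventually_elim auto
    then show False using notin by blast
  qed
  have less: "l < r" if "l \<in> L" "r \<in> R" for l r
  proof -
    have "eventually (\<lambda>x. l < r) U"
      using that le unfolding L_def R_def mem_Collect_eq by eventually_elim linarith
    then show ?thesis using \<open>U \<noteq> bot\<close> by (simp add: eventually_const_iff)
  qed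
  have "eventually (\<lambda>x. b x \<in> L \<or> a x \<in> R) U"
  proof (rule ccontr)
    assume "\<not> ?thesis"
    then have ev: "eventually (\<lambda>x. \<not> (b x \<in> L \<or> a x \<in> R)) U"
      using ultra by blast
    obtain x0 where "\<not> (b x0 \<in> L \<or> a x0 \<in> R)"
      using eventually_happens'[OF \<open>U \<noteq> bot\<close> ev] by blast
    \<comment> \<open>Otherwise almost every interval has its left end in \<open>L\<close> and its
      right end in \<open>R\<close>. One such interval makes \<open>L\<close> nonempty and bounded,
      so \<open>Sup L\<close> is meaningful. Whichever of \<open>L\<close> and \<open>R\<close>
      contains \<open>Sup L\<close>, almost all intervals lie strictly on one side of it, and one
      that still straddles the cut is impossible.\<close>
    then have x0: "b x0 \<in> R" "a x0 \<in> L" using LR by blast+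
    have bdd: "bdd_above L" using less x0 by (meson bdd_aboveI less_imp_le)
    consider "Sup L \<in> L" | "Sup L \<in> R" using LR by blast
    then show False
    proof cases
      case 1
      then have "eventually (\<lambda>x. Sup L < a x) U" by (simp add: L_def)
      with ev have "eventually (\<lambda>x. \<not> (b x \<in> L \<or> a x \<in> R) \<and> Sup L < a x) U"
        by eventually_elim auto
      then obtain x where "a x \<notin> R" "Sup L < a x"
        using eventually_happens'[OF \<open>U \<noteq> bot\<close>] by blast
      then show False using LR cSup_upper[OF _ bdd] by (meson not_le)
    next
      case 2
      then have "eventually (\<lambda>x. b x < Sup L) U" by (simp add: R_def)
      with ev have "eventually (\<lambda>x. \<not> (b x \<in> L \<or> a x \<in> R) \<and> b x < Sup L) U"
        by eventually_elim auto
      then obtain x where x: "b x \<notin> L" "b x < Sup L"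
        using eventually_happens'[OF \<open>U \<noteq> bot\<close>] by blast
      then obtain l where "l \<in> L" "b x < l"
        using less_cSup_iff[OF _ bdd] x0 by blast
      then show False using LR x less by (meson not_less_iff_gr_or_eq)
    qed
  qed
  then show ?thesis
  proof eventually_elim
    case (elim x)
    then show ?case by (auto simp: L_def R_def elim: eventually_mono)
  qed
qed

text \<open>Each chosen element also satisfies \<open>eventually (R (S n)) U\<close>. The next
  choice then has to meet only finitely many conditions that hold almost everywhere, and a proper
  filter provides a point meeting them all.\<close>

lemma eventually_eventually_sequence:
  assumes "U \<noteq> bot" and "eventually (\<lambda>x. eventually (R x) U) U" and "eventually P U"
  obtains S :: "nat \<Rightarrow> 'a" where "\<And>n. P (S n)" "\<And>i j. i < j \<Longrightarrow> R (S i) (S j)"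
proof -
  have "\<exists>S :: nat \<Rightarrow> 'a. \<forall>n. P (S n) \<and> eventually (R (S n)) U \<and> (\<forall>m<n. R (S m) (S n))"
  proof (rule dependent_wellorder_choice)
    fix n and S :: "nat \<Rightarrow> 'a"
    assume IH: "\<And>m. m < n \<Longrightarrow> P (S m) \<and> eventually (R (S m)) U \<and> (\<forall>l<m. R (S l) (S m))"
    have "eventually (\<lambda>y. \<forall>m\<in>{..<n}. R (S m) y) U"
      using IH by (intro eventually_ball_finite) auto
    with assms(2,3) have "eventually (\<lambda>y. P y \<and> eventually (R y) U \<and> (\<forall>m<n. R (S m) y)) U"
      by eventually_elim auto
    then show "\<exists>y. P y \<and> eventually (R y) U \<and> (\<forall>m<n. R (S m) y)"
      using eventually_happens'[OF \<open>U \<noteq> bot\<close>] by blast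
  qed auto
  then show thesis using that by blast
qed

lemma coordinate_flat_Int_cbox:
  fixes a b :: "real ^ 'd"
  assumes "\<forall>i. a $ i \<le> b $ i"
  shows "{x. \<forall>i\<in>I. x $ i = c i} \<inter> cbox a b \<noteq> {} \<longleftrightarrow> (\<forall>i\<in>I. a $ i \<le> c i \<and> c i \<le> b $ i)"
proof
  assume "\<forall>i\<in>I. a $ i \<le> c i \<and> c i \<le> b $ i"
  \<comment> \<open>The coordinates left free by the flat are filled from the lower corner of the
    box.\<close>
  then have "(\<chi> i. if i \<in> I then c i else a $ i) \<in> {x. \<forall>i\<in>I. x $ i = c i} \<inter> cbox a b"
    using assms by (auto simp: mem_box_cart)
  then show "{x. \<forall>i\<in>I. x $ i = c i} \<inter> cbox a b \<noteq> {}" by blast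
next
  assume "{x. \<forall>i\<in>I. x $ i = c i} \<inter> cbox a b \<noteq> {}"
  then obtain x where "\<forall>i\<in>I. x $ i = c i" "\<forall>i. a $ i \<le> x $ i \<and> x $ i \<le> b $ i"
    by (auto simp: mem_box_cart)
  then show "\<forall>i\<in>I. a $ i \<le> c i \<and> c i \<le> b $ i" by metis
qed

theorem theorem7:
  fixes \<F> :: "(real ^ 'd) set set" and k :: nat
  assumes "k < CARD('d)"
    and "infinite \<F>"
    and "\<forall>B\<in>\<F>. axis_parallel_box B"
    and "aleph0_2_property k \<F>"
  shows "\<exists>\<K>. finite \<K> \<and> (\<forall>K\<in>\<K>. axis_parallel_flat k K) \<and> transversal \<K> \<F>"
proof (rule ccontr)
  assume no: "\<not> ?thesis"
  define M where "M K = {B \<in> \<F>. K \<inter> B = {}}" for K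
  define L where "L = inf (principal \<F>) (INF K\<in>{K. axis_parallel_flat k K}. principal (M K))"
  have "L \<noteq> bot"
  proof
    \<comment> \<open>An event of the infimum already holds for a finite subfamily: finitely many
      sets \<open>M K\<close> have no common box of \<F>, so these flats form a transversal.\<close>
    assume "L = bot"
    then have "eventually (\<lambda>B. B \<notin> \<F>) (INF K\<in>{K. axis_parallel_flat k K}. principal (M K))"
      by (simp add: L_def inf.commute[of "principal \<F>"] eventually_inf_principal flip: eventually_False)
    then obtain \<K> where \<K>: "\<K> \<subseteq> {K. axis_parallel_flat k K}" "finite \<K>"
      "eventually (\<lambda>B. B \<notin> \<F>) (INF K\<in>\<K>. principal (M K))"
      unfolding eventually_INF[where B = "{K. axis_parallel_flat k K}"] by blast
    then have "\<forall>B\<in>(\<Inter>K\<in>\<K>. M K). B \<notin> \<F>"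
      unfolding INF_principal_finite[OF \<K>(2)] eventually_principal by blast
    then have "transversal \<K> \<F>"
      unfolding transversal_def M_def by blast
    then show False using no \<K> by blast
  qed
  then obtain U where U: "U \<le> L" "U \<noteq> bot"
    and ultra: "\<And>P. eventually P U \<or> eventually (\<lambda>x. \<not> P x) U"
    using ultrafilter_le_exists by blast
  have ev\<F>: "eventually (\<lambda>B. B \<in> \<F>) U"
    using U(1) by (simp add: L_def le_principal)
  have ev_miss: "eventually (\<lambda>B. K \<inter> B = {}) U" if "axis_parallel_flat k K" for K
  proof -
    have "U \<le> principal (M K)"
      using U(1) that by (simp add: L_def le_INF_iff)
    then show ?thesis by (auto simp: le_principal M_def elim: eventually_mono)
  qed
  obtain a b where ab: "\<And>B. B \<in> \<F> \<Longrightarrow> (\<forall>i. a B $ i \<le> b B $ i) \<and> B = cbox (a B) (b B)"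
    using assms(3) unfolding axis_parallel_box_def by metis
  define G where "G = {i. \<exists>t. eventually (\<lambda>B. a B $ i \<le> t \<and> t \<le> b B $ i) U}"
  \<comment> \<open>\<open>D\<close> demands separation in every bad coordinate at once. There are
    finitely many coordinates, so the statements for single coordinates combine at both levels of
    \<open>eventually\<close>.\<close>
  define D where "D B B' \<longleftrightarrow> (\<forall>i\<in>-G. b B $ i < a B' $ i \<or> b B' $ i < a B $ i)" for B B'
  have "eventually (\<lambda>B. eventually (\<lambda>B'. b B $ i < a B' $ i \<or> b B' $ i < a B $ i) U) U"
    if "i \<in> -G" for i
    using ev\<F> ab that U(2) ultra
    by (intro ultrafilter_intervals_disjoint) (auto simp: G_def elim: eventually_mono)
  then have "eventually (\<lambda>B. \<forall>i\<in>-G.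
      eventually (\<lambda>B'. b B $ i < a B' $ i \<or> b B' $ i < a B $ i) U) U"
    by (intro eventually_ball_finite) auto
  then have "eventually (\<lambda>B. eventually (D B) U) U"
    unfolding D_def by (rule eventually_mono) (intro eventually_ball_finite, auto)
  then obtain S where S: "\<And>n::nat. S n \<in> \<F>" "\<And>i j. i < j \<Longrightarrow> D (S i) (S j)"
    using eventually_eventually_sequence[OF U(2) _ ev\<F>] by metis
  then obtain m n K where "m \<noteq> n" and K: "axis_parallel_flat k K" "K \<inter> S m \<noteq> {}" "K \<inter> S n \<noteq> {}"
    using assms(4) unfolding aleph0_2_property_def by metis
  then have D_mn: "D (S m) (S n) \<or> D (S n) (S m)"
    using S(2) by (meson linorder_neqE_nat)
  from K(1) obtain I :: "'d set" and c
    where I: "card I + k = CARD('d)" "K = {x. \<forall>i\<in>I. x $ i = c i}"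
    unfolding axis_parallel_flat_def by blast
  have "\<forall>i\<in>I. a (S l) $ i \<le> c i \<and> c i \<le> b (S l) $ i" if "K \<inter> S l \<noteq> {}" for l
    using that ab[OF S(1)[of l]] coordinate_flat_Int_cbox[of "a (S l)" "b (S l)" I c]
    unfolding I(2) by simp
  then have "\<forall>i\<in>I. a (S m) $ i \<le> c i \<and> c i \<le> b (S m) $ i \<and>
      a (S n) $ i \<le> c i \<and> c i \<le> b (S n) $ i"
    using K(2,3) by blast
  \<comment> \<open>In each coordinate fixed by \<open>K\<close>, the two boxes share the value
    \<open>c i\<close>; in a bad coordinate \<open>D\<close> rules this out.\<close>
  with D_mn have "I \<subseteq> G"
    unfolding D_def by force
  then have "\<forall>i\<in>I. \<exists>t. eventually (\<lambda>B. a B $ i \<le> t \<and> t \<le> b B $ i) U"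
    unfolding G_def by blast
  then obtain t where t: "\<forall>i\<in>I. eventually (\<lambda>B. a B $ i \<le> t i \<and> t i \<le> b B $ i) U"
    unfolding bchoice_iff by blast
  define K' where "K' = {x :: real ^ 'd. \<forall>i\<in>I. x $ i = t i}"
  have "eventually (\<lambda>B. K' \<inter> B = {}) U"
    by (rule ev_miss) (use I(1) in \<open>auto simp: axis_parallel_flat_def K'_def\<close>)
  moreover have "eventually (\<lambda>B. \<forall>i\<in>I. a B $ i \<le> t i \<and> t i \<le> b B $ i) U"
    using t by (intro eventually_ball_finite) auto
  ultimately have "eventually (\<lambda>B. False) U"
    using ev\<F>
  proof eventually_elim
    case (elim B)
    then show ?case
      using ab[OF elim(3)] coordinate_flat_Int_cbox[of "a B" "b B" I t] unfolding K'_def by simp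
  qed
  then show False using U(2) by (simp add: trivial_limit_def)
qed

end
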